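(* Let $d,n\ge 1$ be integers, let $A=[a_{i_1,\ldots,i_d}]_{i_1,\ldots,i_d=1}^n$ be a real array, and let $\xi=(\xi_i)_{i=1}^n\in L^n_{\psi_d}(\Omega,\Sigma,\mathbb{P})$. Put $d'=d/(d-1)$. Let $C>0$ be a universal constant such that every centered random variable $\eta$ with $\|\eta\|_{\psi_1}<\infty$ satisfies $\mathbb{E}\exp(t\eta)\le\exp\big(C^2\|\eta\|_{\psi_1}^2t^2\big)$ for all real $t$ with $C\|\eta\|_{\psi_1}|t|\le 1$. Then for every $t\ge 0$ $$\mathbb{P}\Big(\big|S_d(\xi)-\mathbb{E}S_d(\xi)\big|\ge t\Big)\le 2e^{-g(t)},$$ where $$g(t)=\begin{cases}\dfrac{t^2}{16C^2\|A\|_{d'}^2\|\xi\|_{E_d}^{2d}} & \text{if } 0\le t\le 4C\|A\|_{d'}\|\xi\|_{E_d}^d,\\[2ex] \dfrac{t}{2C\|A\|_{d'}\|\xi\|_{E_d}^d}-1 & \text{if } t>4C\|A\|_{d'}\|\xi\|_{E_d}^d.\end{cases}$$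
   Context: For a real random variable $\eta$ and $p\ge 1$, $\|\eta\|_{\psi_p}=\inf\{K>0:\ \mathbb{E}\exp(|\eta/K|^p)\le 2\}$ (with value $\infty$ if no such $K$ exists). $L^n_{\psi_p}(\Omega,\Sigma,\mathbb{P})$ denotes the space of random vectors $\xi=(\xi_i)_{i=1}^n:\Omega\to\mathbb{R}^n$ on the probability space $(\Omega,\Sigma,\mathbb{P})$ all of whose coordinates satisfy $\|\xi_i\|_{\psi_p}<\infty$ (no independence or centering is assumed). For such a vector, $$\|\xi\|_{E_p}=\inf\Big\{K>0:\ \mathbb{E}\exp\Big(\frac{\sum_{i=1}^n|\xi_i|^p}{K^p}\Big)\le 2\Big\}.$$ For a real array $A=[a_{i_1,\ldots,i_d}]_{i_1,\ldots,i_d=1}^n$, $\|A\|_p=\big(\sum_{i_1,\ldots,i_d=1}^n|a_{i_1,\ldots,i_d}|^p\big)^{1/p}$ for $1\le p<\infty$ and $\|A\|_\infty=\max_{1\le i_1,\ldots,i_d\le n}|a_{i_1,\ldots,i_d}|$; as usual, $d'=d/(d-1)$ is read as $\infty$ when $d=1$. The chaos of order $d$ is $S_d(\xi)$, where $S_d(x)=\sum_{i_1,\ldots,i_d=1}^n a_{i_1,\ldots,i_d}x_{i_1}\cdots x_{i_d}$ for $x=(x_1,\ldots,x_n)\in\mathbb{R}^n$. It is a known fact that a universal constant $C$ as in the claim exists. *)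

theory Defs
  imports "HOL-Probability.Probability"
begin

definition psi_norm :: "'a measure \<Rightarrow> real \<Rightarrow> ('a \<Rightarrow> real) \<Rightarrow> ereal" where
  "psi_norm M p \<eta> =
     (INF K \<in> {K. 0 < K \<and> (\<integral>\<^sup>+ \<omega>. ennreal (exp (\<bar>\<eta> \<omega> / K\<bar> powr p)) \<partial>M) \<le> 2}. ereal K)"

text \<open>A random vector is given by its coordinates \<open>\<xi> 1, \<dots>, \<xi> n\<close>; values of \<open>\<xi>\<close> at other
  indices are irrelevant throughout.\<close>

definition L_psi :: "'a measure \<Rightarrow> real \<Rightarrow> nat \<Rightarrow> (nat \<Rightarrow> 'a \<Rightarrow> real) set" where
  "L_psi M p n = {\<xi>. \<forall>i\<in>{1..n}. \<xi> i \<in> borel_measurable M \<and> psi_norm M p (\<xi> i) < \<infinity>}"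

definition E_norm :: "'a measure \<Rightarrow> real \<Rightarrow> nat \<Rightarrow> (nat \<Rightarrow> 'a \<Rightarrow> real) \<Rightarrow> ereal" where
  "E_norm M p n \<xi> =
     (INF K \<in> {K. 0 < K \<and>
        (\<integral>\<^sup>+ \<omega>. ennreal (exp ((\<Sum>i=1..n. \<bar>\<xi> i \<omega>\<bar> powr p) / K powr p)) \<partial>M) \<le> 2}. ereal K)"

text \<open>The multi-indices \<open>(i\<^sub>1, \<dots>, i\<^sub>d)\<close> with entries in \<open>{1..n}\<close>; an array is a real function
  on these.\<close>

definition multi_indices :: "nat \<Rightarrow> nat \<Rightarrow> (nat \<Rightarrow> nat) set" where
  "multi_indices d n = {1..d} \<rightarrow>\<^sub>E {1..n}"

definition array_norm :: "nat \<Rightarrow> nat \<Rightarrow> ereal \<Rightarrow> ((nat \<Rightarrow> nat) \<Rightarrow> real) \<Rightarrow> real" where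
  "array_norm d n p A =
     (if p = \<infinity> then Max ((\<lambda>i. \<bar>A i\<bar>) ` multi_indices d n)
      else (\<Sum>i\<in>multi_indices d n. \<bar>A i\<bar> powr real_of_ereal p) powr (1 / real_of_ereal p))"

definition dual_exponent :: "nat \<Rightarrow> ereal" where
  "dual_exponent d = (if d = 1 then \<infinity> else ereal (real d / (real d - 1)))"

definition chaos :: "nat \<Rightarrow> nat \<Rightarrow> ((nat \<Rightarrow> nat) \<Rightarrow> real) \<Rightarrow> (nat \<Rightarrow> real) \<Rightarrow> real" where
  "chaos d n A x = (\<Sum>i\<in>multi_indices d n. A i * (\<Prod>k=1..d. x (i k)))"

text \<open>HOL cannot quantify over all types inside a formula, so the probability spaces here are
  those with points in \<open>real\<close> (with arbitrary \<open>\<sigma>\<close>-algebra). Nothing is lost: the condition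
  depends only on the law of \<open>\<eta>\<close>, and every law on the line is that of the identity on such a
  space.\<close>

definition mgf_constant :: "real \<Rightarrow> bool" where
  "mgf_constant C \<longleftrightarrow>
     (\<forall>(N :: real measure) \<eta> t.
        prob_space N \<longrightarrow> \<eta> \<in> borel_measurable N \<longrightarrow> psi_norm N 1 \<eta> < \<infinity> \<longrightarrow>
        integrable N \<eta> \<longrightarrow> integral\<^sup>L N \<eta> = 0 \<longrightarrow>
        C * real_of_ereal (psi_norm N 1 \<eta>) * \<bar>t\<bar> \<le> 1 \<longrightarrow>
        (\<integral>\<^sup>+ x. ennreal (exp (t * \<eta> x)) \<partial>N)
          \<le> ennreal (exp (C\<^sup>2 * (real_of_ereal (psi_norm N 1 \<eta>))\<^sup>2 * t\<^sup>2)))"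

text \<open>The function \<open>g\<close>, with \<open>a\<close> and \<open>x\<close> standing for the norms of the array and of the vector.
  The quotients are taken in \<open>ereal\<close>, where \<open>t / 0 = \<infinity>\<close> for \<open>t > 0\<close> and \<open>0 / 0 = 0\<close>. So if
  one of the norms vanishes, \<open>g t = \<infinity>\<close> for every \<open>t > 0\<close>, whereas real division would give \<open>-1\<close>.\<close>

definition tail_exponent :: "real \<Rightarrow> nat \<Rightarrow> real \<Rightarrow> real \<Rightarrow> real \<Rightarrow> ereal" where
  "tail_exponent C d a x t =
     (if t \<le> 4 * C * a * x ^ d
      then ereal (t\<^sup>2) / ereal (16 * C\<^sup>2 * a\<^sup>2 * x ^ (2 * d))
      else ereal t / ereal (2 * C * a * x ^ d) - 1)"

text \<open>The value \<open>e\<^sup>-\<^sup>s\<close> for \<open>s > -\<infinity>\<close>.\<close>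

definition exp_minus :: "ereal \<Rightarrow> real" where
  "exp_minus s = (if s = \<infinity> then 0 else exp (- real_of_ereal s))"

end

theory Submission
  imports Defs
begin

text \<open>Let \<open>p'\<close> be the dual exponent of \<open>d\<close>. Hoelder's inequality gives
  \<open>\<bar>S(x)\<bar> \<le> \<parallel>A\<parallel>\<^bsub>p'\<^esub> \<Sum>\<^sub>j \<bar>x\<^sub>j\<bar>\<^sup>d\<close>, because summing \<open>\<Prod>\<^sub>k \<bar>x(i\<^sub>k)\<bar>\<^sup>d\<close> over all multi-indices yields
  \<open>(\<Sum>\<^sub>j \<bar>x\<^sub>j\<bar>\<^sup>d)\<^sup>d\<close>. Hence the \<open>\<psi>\<^sub>1\<close> norm of \<open>S(\<xi>)\<close> is at most \<open>\<parallel>A\<parallel>\<^bsub>p'\<^esub>\<close> times the \<open>d\<close>-th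
  power of the \<open>E\<^sub>d\<close> norm of \<open>\<xi>\<close>. Centering at most doubles it, and Chernoff's bound, with the
  parameter optimised over the admissible range, gives the tail estimate. When the bound on the
  \<open>\<psi>\<^sub>1\<close> norm is zero, every parameter is admissible, so the tail vanishes.\<close>

section \<open>Hoelder's inequality and the pointwise bound on the chaos\<close>

lemma Holder_inequality_sum:
  fixes f g :: "'i \<Rightarrow> real"
  assumes "finite I" "1 < p" "1 < q" "1 / p + 1 / q = 1"
  shows "(\<Sum>i\<in>I. \<bar>f i\<bar> * \<bar>g i\<bar>)
    \<le> (\<Sum>i\<in>I. \<bar>f i\<bar> powr p) powr (1 / p) * (\<Sum>i\<in>I. \<bar>g i\<bar> powr q) powr (1 / q)"
proof -
  define F where "F = (\<Sum>i\<in>I. \<bar>f i\<bar> powr p)"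
  define G where "G = (\<Sum>i\<in>I. \<bar>g i\<bar> powr q)"
  define P where "P = F powr (1 / p)"
  define Q where "Q = G powr (1 / q)"
  have FG: "F \<ge> 0" "G \<ge> 0" by (auto simp: F_def G_def intro!: sum_nonneg)
  show ?thesis
  proof (cases "F = 0 \<or> G = 0")
    case True
    then have "(\<forall>i\<in>I. f i = 0) \<or> (\<forall>i\<in>I. g i = 0)"
      using assms(1) by (auto simp: F_def G_def sum_nonneg_eq_0_iff)
    then have "(\<Sum>i\<in>I. \<bar>f i\<bar> * \<bar>g i\<bar>) = 0"
      by (auto intro!: sum.neutral)
    then show ?thesis by simp
  next
    case False
    with FG have FG: "F > 0" "G > 0" by auto
    then have PQ: "P > 0" "Q > 0" by (auto simp: P_def Q_def)
    have Pp: "P powr p = F" and Qq: "Q powr q = G"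
      using FG assms by (auto simp: P_def Q_def powr_powr)
    \<comment> \<open>After both families are normalised, Young's inequality applies termwise and
      its right-hand sides add up to \<open>1 / p + 1 / q = 1\<close>.\<close>
    have "(\<Sum>i\<in>I. \<bar>f i\<bar> * \<bar>g i\<bar>) / (P * Q) = (\<Sum>i\<in>I. (\<bar>f i\<bar> / P) * (\<bar>g i\<bar> / Q))"
      by (simp add: sum_divide_distrib)
    also have "\<dots> \<le> (\<Sum>i\<in>I. (\<bar>f i\<bar> / P) powr p / p + (\<bar>g i\<bar> / Q) powr q / q)"
      using PQ assms by (intro sum_mono Youngs_inequality) auto
    also have "\<dots> = (\<Sum>i\<in>I. \<bar>f i\<bar> powr p / F / p + \<bar>g i\<bar> powr q / G / q)"
      using PQ by (simp add: powr_divide Pp Qq)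
    also have "\<dots> = F / F / p + G / G / q"
      unfolding sum.distrib sum_divide_distrib[symmetric] by (simp add: F_def G_def)
    also have "\<dots> = 1"
      using FG assms by simp
    finally have "(\<Sum>i\<in>I. \<bar>f i\<bar> * \<bar>g i\<bar>) \<le> P * Q"
      using PQ by (simp add: divide_le_eq)
    then show ?thesis by (simp add: P_def Q_def F_def G_def)
  qed
qed

lemma finite_multi_indices [simp]: "finite (multi_indices d n)"
  by (simp add: multi_indices_def finite_PiE)

lemma sum_multi_indices_prod:
  fixes f :: "nat \<Rightarrow> real"
  shows "(\<Sum>i\<in>multi_indices d n. \<Prod>k=1..d. f (i k)) = (\<Sum>j=1..n. f j) ^ d"
  using prod_sum_PiE[of "{1..d}" "\<lambda>_. {1..n}" "\<lambda>_. f"]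
  by (simp add: multi_indices_def)

lemma array_norm_nonneg:
  assumes "n \<ge> 1"
  shows "0 \<le> array_norm d n p A"
proof -
  \<comment> \<open>The constant multi-index shows that the maximum defining the sup norm is taken
    over a nonempty set.\<close>
  have "(\<lambda>k\<in>{1..d}. 1) \<in> multi_indices d n"
    using assms by (auto simp: multi_indices_def)
  then have "0 \<le> Max ((\<lambda>i. \<bar>A i\<bar>) ` multi_indices d n)"
    by (subst Max_ge_iff) auto
  then show ?thesis
    by (auto simp: array_norm_def)
qed

text \<open>For \<open>d > 1\<close>, Hoelder is applied to the entries with exponent
  \<open>q = d / (d - 1)\<close> and to the products with exponent \<open>d\<close>; the outer power
  \<open>1 / d\<close> turns the \<open>d\<close>-th power of the sum over \<open>j\<close> back
  into that sum. For \<open>d = 1\<close> the dual exponent is infinite, so each entry is bounded by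
  the maximum instead.\<close>

lemma abs_chaos_le:
  assumes "d \<ge> 1"
  shows "\<bar>chaos d n A x\<bar> \<le> array_norm d n (dual_exponent d) A * (\<Sum>j=1..n. \<bar>x j\<bar> ^ d)"
proof -
  have *: "\<bar>chaos d n A x\<bar> \<le> (\<Sum>i\<in>multi_indices d n. \<bar>A i\<bar> * (\<Prod>k=1..d. \<bar>x (i k)\<bar>))"
    unfolding chaos_def by (rule order_trans[OF sum_abs]) (simp add: abs_mult abs_prod)
  show ?thesis
  proof (cases "d = 1")
    case True
    have "(\<Sum>i\<in>multi_indices d n. \<bar>A i\<bar> * (\<Prod>k=1..d. \<bar>x (i k)\<bar>))
      \<le> (\<Sum>i\<in>multi_indices d n. array_norm d n \<infinity> A * (\<Prod>k=1..d. \<bar>x (i k)\<bar>))"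
      by (intro sum_mono mult_right_mono) (auto simp: array_norm_def intro!: prod_nonneg Max_ge)
    also have "\<dots> = array_norm d n \<infinity> A * (\<Sum>j=1..n. \<bar>x j\<bar>) ^ d"
      unfolding sum_multi_indices_prod[symmetric] sum_distrib_left ..
    finally show ?thesis using * True by (simp add: dual_exponent_def)
  next
    case False
    with assms have d: "real d > 1" by auto
    define q where "q = real d / (real d - 1)"
    have q: "q > 1" "1 / q + 1 / real d = 1" using d by (auto simp: q_def field_simps)
    let ?Y = "\<Sum>j=1..n. \<bar>x j\<bar> ^ d"
    have Y: "?Y \<ge> 0" by (intro sum_nonneg) auto
    have "(\<Sum>i\<in>multi_indices d n. \<bar>\<Prod>k=1..d. \<bar>x (i k)\<bar>\<bar> powr real d)
      = (\<Sum>i\<in>multi_indices d n. \<Prod>k=1..d. \<bar>x (i k)\<bar> ^ d)"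
      using d by (intro sum.cong refl) (simp add: powr_realpow' prod_nonneg prod_power_distrib abs_prod)
    also have "\<dots> = ?Y ^ d"
      by (rule sum_multi_indices_prod)
    also have "\<dots> = ?Y powr real d"
      using Y assms by (intro powr_realpow'[symmetric]) auto
    finally have W: "(\<Sum>i\<in>multi_indices d n. \<bar>\<Prod>k=1..d. \<bar>x (i k)\<bar>\<bar> powr real d) powr (1 / real d) = ?Y"
      using Y d by (simp only: powr_powr) simp
    have "(\<Sum>i\<in>multi_indices d n. \<bar>A i\<bar> * (\<Prod>k=1..d. \<bar>x (i k)\<bar>))
      = (\<Sum>i\<in>multi_indices d n. \<bar>A i\<bar> * \<bar>\<Prod>k=1..d. \<bar>x (i k)\<bar>\<bar>)"
      by (simp add: abs_prod)
    also have "\<dots> \<le> (\<Sum>i\<in>multi_indices d n. \<bar>A i\<bar> powr q) powr (1 / q) * ?Y"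
      using Holder_inequality_sum[OF _ q(1) d q(2), of "multi_indices d n" A "\<lambda>i. \<Prod>k=1..d. \<bar>x (i k)\<bar>"]
      unfolding W by simp
    finally show ?thesis
      using * False by (simp add: dual_exponent_def array_norm_def q_def)
  qed
qed

section \<open>The exponential norms of variables and vectors\<close>

lemma psi_norm_nonneg: "0 \<le> psi_norm M p \<eta>"
  unfolding psi_norm_def by (intro INF_greatest) auto

lemma psi_norm_1_le:
  assumes "0 < K" "(\<integral>\<^sup>+ \<omega>. ennreal (exp (\<bar>\<eta> \<omega>\<bar> / K)) \<partial>M) \<le> 2"
  shows "psi_norm M 1 \<eta> \<le> ereal K"
  unfolding psi_norm_def using assms by (intro INF_lower) (auto simp: abs_divide)

text \<open>Needed because \<open>mgf_constant\<close> quantifies over measures on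
  \<open>real\<close> only: a variable on an arbitrary space is replaced by the identity under its
  law.\<close>

lemma psi_norm_distr:
  assumes [measurable]: "\<eta> \<in> borel_measurable M"
  shows "psi_norm (distr M borel \<eta>) p (\<lambda>x. x) = psi_norm M p \<eta>"
  unfolding psi_norm_def by (simp add: nn_integral_distr)

lemma E_norm_nonneg: "0 \<le> E_norm M p n \<xi>"
  unfolding E_norm_def by (intro INF_greatest) auto

text \<open>Strictness yields an admissible \<open>K'\<close> below \<open>K\<close>, and the
  integrand decreases as the scale grows. Whether the infimum is itself admissible is thus never
  asked; it is not when it equals 0.\<close>

lemma nn_integral_exp_le_2_if_E_norm_less:
  assumes "E_norm M p n \<xi> < ereal K" "0 \<le> p"
  shows "(\<integral>\<^sup>+ \<omega>. ennreal (exp ((\<Sum>i=1..n. \<bar>\<xi> i \<omega>\<bar> powr p) / K powr p)) \<partial>M) \<le> 2"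
proof -
  obtain K' where K': "0 < K'" "K' < K"
    "(\<integral>\<^sup>+ \<omega>. ennreal (exp ((\<Sum>i=1..n. \<bar>\<xi> i \<omega>\<bar> powr p) / K' powr p)) \<partial>M) \<le> 2"
    using assms(1) unfolding E_norm_def INF_less_iff by auto
  have "(\<integral>\<^sup>+ \<omega>. ennreal (exp ((\<Sum>i=1..n. \<bar>\<xi> i \<omega>\<bar> powr p) / K powr p)) \<partial>M)
    \<le> (\<integral>\<^sup>+ \<omega>. ennreal (exp ((\<Sum>i=1..n. \<bar>\<xi> i \<omega>\<bar> powr p) / K' powr p)) \<partial>M)"
    using K'(1,2) assms(2)
    by (intro nn_integral_mono ennreal_leI) (auto intro!: divide_left_mono sum_nonneg powr_mono2)
  with K'(3) show ?thesis by simp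
qed

text \<open>No independence is available to factor the exponential of the sum. Convexity of
  \<open>exp\<close> replaces it: the exponential of an average is at most the average of
  exponentials, each of which has expectation at most 2.\<close>

lemma E_norm_finite:
  assumes "\<xi> \<in> L_psi M p n" "0 < p" "n \<ge> 1"
  shows "E_norm M p n \<xi> < \<infinity>"
proof -
  have meas [measurable]: "\<xi> i \<in> borel_measurable M" if "i \<in> {1..n}" for i
    using that assms(1) by (auto simp: L_psi_def)
  have "\<exists>K>0. (\<integral>\<^sup>+ \<omega>. ennreal (exp (\<bar>\<xi> i \<omega> / K\<bar> powr p)) \<partial>M) \<le> 2" if "i \<in> {1..n}" for i
  proof -
    have "psi_norm M p (\<xi> i) < \<infinity>" using that assms(1) by (auto simp: L_psi_def)
    then show ?thesis unfolding psi_norm_def INF_less_iff by auto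
  qed
  then obtain k where k: "\<And>i. i \<in> {1..n} \<Longrightarrow> k i > 0"
    "\<And>i. i \<in> {1..n} \<Longrightarrow> (\<integral>\<^sup>+ \<omega>. ennreal (exp (\<bar>\<xi> i \<omega> / k i\<bar> powr p)) \<partial>M) \<le> 2"
    by metis
  define m where "m = (\<Sum>i=1..n. k i powr p)"
  have km: "0 < k i powr p" "k i powr p \<le> m" if "i \<in> {1..n}" for i
    using k(1)[OF that] that by (auto simp: m_def intro!: member_le_sum)
  have "m > 0" using assms(3) by (intro less_le_trans[OF km(1)[of 1] km(2)[of 1]]) auto
  \<comment> \<open>Then \<open>K powr p = n * m\<close>, so the exponent becomes the average, with
    weights \<open>1 / n\<close>, of the terms
    \<open>\<bar>\<xi> i \<omega>\<bar> powr p / m\<close>; and \<open>m\<close> dominates every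
    \<open>k i powr p\<close>.\<close>
  define K where "K = (real n * m) powr (1 / p)"
  have "K > 0" "K powr p = real n * m"
    using \<open>m > 0\<close> assms by (auto simp: K_def powr_powr)
  have le: "exp ((\<Sum>i=1..n. \<bar>\<xi> i \<omega>\<bar> powr p) / K powr p)
    \<le> (\<Sum>i=1..n. 1 / real n * exp (\<bar>\<xi> i \<omega> / k i\<bar> powr p))" for \<omega>
  proof -
    have "exp ((\<Sum>i=1..n. \<bar>\<xi> i \<omega>\<bar> powr p) / K powr p)
      = exp (\<Sum>i=1..n. (1 / real n) *\<^sub>R (\<bar>\<xi> i \<omega>\<bar> powr p / m))"
      by (simp add: \<open>K powr p = _\<close> sum_divide_distrib)
    also have "\<dots> \<le> (\<Sum>i=1..n. 1 / real n * exp (\<bar>\<xi> i \<omega>\<bar> powr p / m))"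
      using assms(3) by (intro convex_on_sum[OF _ _ exp_convex]) auto
    also have "\<dots> \<le> (\<Sum>i=1..n. 1 / real n * exp (\<bar>\<xi> i \<omega> / k i\<bar> powr p))"
    proof (intro sum_mono mult_left_mono)
      fix i assume i: "i \<in> {1..n}"
      have "\<bar>\<xi> i \<omega>\<bar> powr p / m \<le> \<bar>\<xi> i \<omega>\<bar> powr p / k i powr p"
        using km[OF i] \<open>m > 0\<close> by (intro divide_left_mono) auto
      also have "\<dots> = \<bar>\<xi> i \<omega> / k i\<bar> powr p"
        using k(1)[OF i] by (simp add: powr_divide abs_divide)
      finally show "exp (\<bar>\<xi> i \<omega>\<bar> powr p / m) \<le> exp (\<bar>\<xi> i \<omega> / k i\<bar> powr p)" by simp
    qed auto
    finally show ?thesis .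
  qed
  have "(\<integral>\<^sup>+ \<omega>. ennreal (exp ((\<Sum>i=1..n. \<bar>\<xi> i \<omega>\<bar> powr p) / K powr p)) \<partial>M)
    \<le> (\<integral>\<^sup>+ \<omega>. (\<Sum>i=1..n. ennreal (1 / real n) * ennreal (exp (\<bar>\<xi> i \<omega> / k i\<bar> powr p))) \<partial>M)"
  proof (intro nn_integral_mono)
    fix \<omega>
    have "ennreal (exp ((\<Sum>i=1..n. \<bar>\<xi> i \<omega>\<bar> powr p) / K powr p))
      \<le> ennreal (\<Sum>i=1..n. 1 / real n * exp (\<bar>\<xi> i \<omega> / k i\<bar> powr p))"
      by (rule ennreal_leI[OF le])
    also have "\<dots> = (\<Sum>i=1..n. ennreal (1 / real n * exp (\<bar>\<xi> i \<omega> / k i\<bar> powr p)))"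
      by (intro sum_ennreal[symmetric]) simp
    also have "\<dots> = (\<Sum>i=1..n. ennreal (1 / real n) * ennreal (exp (\<bar>\<xi> i \<omega> / k i\<bar> powr p)))"
      by (intro sum.cong refl ennreal_mult') simp
    finally show "ennreal (exp ((\<Sum>i=1..n. \<bar>\<xi> i \<omega>\<bar> powr p) / K powr p))
      \<le> (\<Sum>i=1..n. ennreal (1 / real n) * ennreal (exp (\<bar>\<xi> i \<omega> / k i\<bar> powr p)))"
      .
  qed
  also have "\<dots> = (\<Sum>i=1..n. \<integral>\<^sup>+ \<omega>. ennreal (1 / real n) * ennreal (exp (\<bar>\<xi> i \<omega> / k i\<bar> powr p)) \<partial>M)"
    by (rule nn_integral_sum) measurable
  also have "\<dots> = (\<Sum>i=1..n. ennreal (1 / real n) * (\<integral>\<^sup>+ \<omega>. ennreal (exp (\<bar>\<xi> i \<omega> / k i\<bar> powr p)) \<partial>M))"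
    by (intro sum.cong refl nn_integral_cmult) measurable
  also have "\<dots> \<le> (\<Sum>i=1..n. ennreal (1 / real n) * ennreal 2)"
    using k(2) by (intro sum_mono mult_left_mono) auto
  also have "\<dots> = (\<Sum>i=1..n. ennreal (1 / real n * 2))"
    by (intro sum.cong refl ennreal_mult'[symmetric]) simp
  also have "\<dots> = ennreal (\<Sum>i=1..n. 1 / real n * 2)"
    by (intro sum_ennreal) simp
  also have "\<dots> = 2"
    using assms(3) by simp
  finally have "E_norm M p n \<xi> \<le> ereal K"
    unfolding E_norm_def using \<open>K > 0\<close> by (intro INF_lower) auto
  then show ?thesis by auto
qed

section \<open>Centering, moment generating functions and Chernoff's bound\<close>

context prob_space
begin

lemma integrable_if_nn_integral_exp_abs:
  fixes f :: "'a \<Rightarrow> real"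
  assumes [measurable]: "f \<in> borel_measurable M" and "0 < K"
    and "(\<integral>\<^sup>+ \<omega>. ennreal (exp (\<bar>f \<omega>\<bar> / K)) \<partial>M) < \<infinity>"
  shows "integrable M f"
proof -
  have "integrable M (\<lambda>\<omega>. K * exp (\<bar>f \<omega>\<bar> / K))"
    using assms(3) by (intro integrable_mult_right integrableI_nonneg) auto
  then show ?thesis
  proof (rule Bochner_Integration.integrable_bound)
    have "\<bar>y\<bar> \<le> K * exp (\<bar>y\<bar> / K)" for y
      using exp_ge_add_one_self[of "\<bar>y\<bar> / K"] \<open>0 < K\<close> by (simp add: field_simps)
    then show "AE \<omega> in M. norm (f \<omega>) \<le> norm (K * exp (\<bar>f \<omega>\<bar> / K))"
      using \<open>0 < K\<close> by simp
  qed measurable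
qed

text \<open>Let \<open>u\<close> be the expectation of \<open>exp (\<bar>f\<bar> / (2 * K))\<close>.
  Nonnegativity of the variance gives \<open>u\<^sup>2 \<le> 2\<close>, and Jensen bounds
  \<open>exp (\<bar>expectation f\<bar> / (2 * K))\<close> by \<open>u\<close>. By the triangle
  inequality the integral in question is at most \<open>u * u\<close>, so doubling the scale pays
  exactly for the centering.\<close>

lemma nn_integral_exp_abs_centered_le_2:
  fixes f :: "'a \<Rightarrow> real"
  assumes [measurable]: "f \<in> borel_measurable M" and K: "0 < K"
    and le: "(\<integral>\<^sup>+ \<omega>. ennreal (exp (\<bar>f \<omega>\<bar> / K)) \<partial>M) \<le> 2"
  shows "(\<integral>\<^sup>+ \<omega>. ennreal (exp (\<bar>f \<omega> - expectation f\<bar> / (2 * K))) \<partial>M) \<le> 2"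
proof -
  define h where "h = (\<lambda>\<omega>. \<bar>f \<omega>\<bar> / (2 * K))"
  define u where "u = expectation (\<lambda>\<omega>. exp (h \<omega>))"
  have [measurable]: "h \<in> borel_measurable M" by (simp add: h_def)
  have sq: "(exp (h \<omega>))\<^sup>2 = exp (\<bar>f \<omega>\<bar> / K)" for \<omega>
    by (simp add: h_def flip: exp_double)
  have fin: "(\<integral>\<^sup>+ \<omega>. ennreal (exp (\<bar>f \<omega>\<bar> / K)) \<partial>M) < \<infinity>"
    using le by (rule le_less_trans) auto
  have intf: "integrable M f"
    by (rule integrable_if_nn_integral_exp_abs[OF assms(1) K fin])
  then have inth: "integrable M h" by (simp add: h_def)
  have int2: "integrable M (\<lambda>\<omega>. (exp (h \<omega>))\<^sup>2)"
    unfolding sq using fin by (intro integrableI_nonneg) auto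
  have int1: "integrable M (\<lambda>\<omega>. exp (h \<omega>))"
    using int2
  proof (rule Bochner_Integration.integrable_bound)
    have "1 \<le> exp (h \<omega>)" for \<omega> using K by (simp add: h_def)
    then show "AE \<omega> in M. norm (exp (h \<omega>)) \<le> norm ((exp (h \<omega>))\<^sup>2)"
      by (auto simp: power2_eq_square)
  qed measurable
  have "u \<ge> 0" unfolding u_def by (intro integral_nonneg_AE) auto
  have "u\<^sup>2 \<le> expectation (\<lambda>\<omega>. (exp (h \<omega>))\<^sup>2)"
    using variance_positive[of "\<lambda>\<omega>. exp (h \<omega>)"] variance_eq[OF int1 int2] by (simp add: u_def)
  also have "ennreal (expectation (\<lambda>\<omega>. (exp (h \<omega>))\<^sup>2)) \<le> ennreal 2"
    using le unfolding sq by (subst nn_integral_eq_integral[symmetric]) (use int2 in \<open>auto simp: sq\<close>)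
  then have "expectation (\<lambda>\<omega>. (exp (h \<omega>))\<^sup>2) \<le> 2"
    by (simp only: ennreal_le_iff zero_le_numeral)
  finally have u2: "u\<^sup>2 \<le> 2" .
  have "\<bar>expectation f\<bar> / (2 * K) \<le> expectation h"
    using K by (simp add: h_def divide_right_mono)
  then have "exp (\<bar>expectation f\<bar> / (2 * K)) \<le> exp (expectation h)" by simp
  also have "\<dots> \<le> u"
    unfolding u_def by (rule jensens_inequality[OF inth _ _ int1 exp_convex]) auto
  finally have eu: "exp (\<bar>expectation f\<bar> / (2 * K)) \<le> u" .
  have "exp (\<bar>f \<omega> - expectation f\<bar> / (2 * K)) \<le> u * exp (h \<omega>)" for \<omega>
  proof -
    have "exp (\<bar>f \<omega> - expectation f\<bar> / (2 * K)) \<le> exp (h \<omega> + \<bar>expectation f\<bar> / (2 * K))"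
      using K by (auto simp: h_def simp flip: add_divide_distrib intro!: divide_right_mono)
    also have "\<dots> \<le> exp (h \<omega>) * u"
      unfolding exp_add using eu by (intro mult_left_mono) auto
    finally show ?thesis by (simp add: mult.commute)
  qed
  then have "(\<integral>\<^sup>+ \<omega>. ennreal (exp (\<bar>f \<omega> - expectation f\<bar> / (2 * K))) \<partial>M)
    \<le> (\<integral>\<^sup>+ \<omega>. ennreal (u * exp (h \<omega>)) \<partial>M)"
    by (intro nn_integral_mono ennreal_leI)
  also have "\<dots> = ennreal (u * u)"
    using int1 \<open>u \<ge> 0\<close> by (subst nn_integral_eq_integral) (auto simp: u_def)
  also have "\<dots> \<le> ennreal 2"
    using u2 by (intro ennreal_leI) (simp add: power2_eq_square)
  finally show ?thesis by simp
qed

text \<open>Passing to the law of \<open>\<eta>\<close> makes \<open>mgf_constant\<close>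
  applicable. An upper bound \<open>B\<close> may replace the norm: a larger \<open>B\<close> only
  narrows the range of \<open>s\<close> and weakens the conclusion.\<close>

lemma nn_integral_exp_le_if_mgf_constant:
  assumes "mgf_constant C" "C > 0" and [measurable]: "\<eta> \<in> borel_measurable M"
    and "integrable M \<eta>" "expectation \<eta> = 0"
    and B: "psi_norm M 1 \<eta> \<le> ereal B" and s: "C * B * \<bar>s\<bar> \<le> 1"
  shows "(\<integral>\<^sup>+ \<omega>. ennreal (exp (s * \<eta> \<omega>)) \<partial>M) \<le> ennreal (exp (C\<^sup>2 * B\<^sup>2 * s\<^sup>2))"
proof -
  define N where "N = distr M borel \<eta>"
  have N: "psi_norm N 1 (\<lambda>x. x) = psi_norm M 1 \<eta>"
    unfolding N_def by (rule psi_norm_distr) fact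
  obtain b where b: "psi_norm M 1 \<eta> = ereal b" "0 \<le> b" "b \<le> B"
    using B psi_norm_nonneg[of M 1 \<eta>] by (cases "psi_norm M 1 \<eta>") auto
  have "C * b * \<bar>s\<bar> \<le> C * B * \<bar>s\<bar>"
    using b \<open>C > 0\<close> by (intro mult_right_mono mult_left_mono) auto
  with s have "C * b * \<bar>s\<bar> \<le> 1" by simp
  moreover have "prob_space N" "integrable N (\<lambda>x. x)" "integral\<^sup>L N (\<lambda>x. x) = 0"
    using assms(4,5) by (auto simp: N_def prob_space_distr integrable_distr_eq integral_distr)
  ultimately have "(\<integral>\<^sup>+ x. ennreal (exp (s * x)) \<partial>N) \<le> ennreal (exp (C\<^sup>2 * b\<^sup>2 * s\<^sup>2))"
    using assms(1)[unfolded mgf_constant_def, rule_format, of N "\<lambda>x. x" s] b(1)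
    by (simp add: N)
  also have "\<dots> \<le> ennreal (exp (C\<^sup>2 * B\<^sup>2 * s\<^sup>2))"
    using b by (intro ennreal_leI) (auto intro!: mult_right_mono mult_left_mono power_mono)
  finally show ?thesis
    by (simp add: N_def nn_integral_distr)
qed

text \<open>The one-sided exponential bound is used for \<eta> and for its negative, and the union
  bound produces the factor 2.\<close>

lemma Chernoff_two_sided:
  assumes "\<And>l. \<bar>l\<bar> = s \<Longrightarrow> (\<integral>\<^sup>+ \<omega>. ennreal (exp (l * \<eta> \<omega>)) \<partial>M) \<le> ennreal (exp v)"
    and [measurable]: "\<eta> \<in> borel_measurable M" and "s > 0"
  shows "prob {\<omega> \<in> space M. \<bar>\<eta> \<omega>\<bar> \<ge> t} \<le> 2 * exp (v - s * t)"
proof -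
  have *: "prob {\<omega> \<in> space M. c * \<eta> \<omega> \<ge> t} \<le> exp (v - s * t)" if "\<bar>c\<bar> = 1" for c
  proof -
    have "emeasure M {\<omega> \<in> space M. c * \<eta> \<omega> \<ge> t}
      \<le> ennreal (exp (- s * t)) * (\<integral>\<^sup>+ \<omega>. ennreal (exp (s * (c * \<eta> \<omega>))) * indicator (space M) \<omega> \<partial>M)"
      using \<open>s > 0\<close> by (intro Chernoff_ineq_nn_integral_ge) auto
    also have "(\<integral>\<^sup>+ \<omega>. ennreal (exp (s * (c * \<eta> \<omega>))) * indicator (space M) \<omega> \<partial>M)
      = (\<integral>\<^sup>+ \<omega>. ennreal (exp (s * c * \<eta> \<omega>)) \<partial>M)"
      by (intro nn_integral_cong) (simp add: mult.assoc)
    also have "ennreal (exp (- s * t)) * \<dots> \<le> ennreal (exp (- s * t)) * ennreal (exp v)"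
      using \<open>s > 0\<close> that by (intro mult_left_mono assms(1)) (auto simp: abs_mult)
    also have "\<dots> = ennreal (exp (v - s * t))"
      by (simp flip: ennreal_mult' exp_add)
    finally show ?thesis by (simp add: emeasure_eq_measure)
  qed
  have "prob {\<omega> \<in> space M. \<bar>\<eta> \<omega>\<bar> \<ge> t}
    = prob ({\<omega> \<in> space M. 1 * \<eta> \<omega> \<ge> t} \<union> {\<omega> \<in> space M. -1 * \<eta> \<omega> \<ge> t})"
    by (intro arg_cong[where f = prob]) auto
  also have "\<dots> \<le> prob {\<omega> \<in> space M. 1 * \<eta> \<omega> \<ge> t} + prob {\<omega> \<in> space M. -1 * \<eta> \<omega> \<ge> t}"
    by (intro measure_Un_le) measurable
  also have "\<dots> \<le> exp (v - s * t) + exp (v - s * t)"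
    by (intro add_mono *) auto
  finally show ?thesis by simp
qed

text \<open>With \<open>B = 2 * (a * x ^ d)\<close>, the quadratic
  \<open>C\<^sup>2 * B\<^sup>2 * s\<^sup>2 - s * t\<close> is to be minimised over positive
  \<open>s\<close> with \<open>C * B * s \<le> 1\<close>. The two branches of the exponent
  correspond to a minimiser inside this range or at its right end.\<close>

lemma prob_abs_ge_le_tail_exponent:
  assumes "mgf_constant C" "C > 0" and [measurable]: "\<eta> \<in> borel_measurable M"
    and "integrable M \<eta>" "expectation \<eta> = 0"
    and \<eta>: "psi_norm M 1 \<eta> \<le> ereal (2 * (a * x ^ d))" and "t \<ge> 0"
  shows "prob {\<omega> \<in> space M. \<bar>\<eta> \<omega>\<bar> \<ge> t} \<le> 2 * exp_minus (tail_exponent C d a x t)"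
proof -
  define B where "B = 2 * (a * x ^ d)"
  have "0 \<le> ereal B"
    using psi_norm_nonneg \<eta> unfolding B_def by (rule order_trans)
  then have "B \<ge> 0" by simp
  have le: "prob {\<omega> \<in> space M. \<bar>\<eta> \<omega>\<bar> \<ge> t} \<le> 2 * exp (C\<^sup>2 * B\<^sup>2 * s\<^sup>2 - s * t)"
    if "s > 0" "C * B * s \<le> 1" for s
  proof (rule Chernoff_two_sided)
    fix l assume "\<bar>l\<bar> = s"
    then show "(\<integral>\<^sup>+ \<omega>. ennreal (exp (l * \<eta> \<omega>)) \<partial>M) \<le> ennreal (exp (C\<^sup>2 * B\<^sup>2 * s\<^sup>2))"
      using nn_integral_exp_le_if_mgf_constant[OF assms(1-5) \<eta>, of l] that
      by (auto simp: B_def)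
  qed (use that in auto)
  have g: "tail_exponent C d a x t
    = (if t \<le> 2 * C * B then ereal (t\<^sup>2) / ereal (4 * C\<^sup>2 * B\<^sup>2) else ereal t / ereal (C * B) - 1)"
  proof -
    have "4 * C * a * x ^ d = 2 * C * B" "2 * C * a * x ^ d = C * B"
      "16 * C\<^sup>2 * a\<^sup>2 * x ^ (2 * d) = 4 * C\<^sup>2 * B\<^sup>2"
      by (simp_all add: B_def power_mult_distrib power_even_eq)
    then show ?thesis by (simp only: tail_exponent_def)
  qed
  consider "t = 0" | "t > 0" "B = 0" | "t > 0" "B > 0" "t \<le> 2 * C * B" | "B > 0" "t > 2 * C * B"
    using \<open>B \<ge> 0\<close> \<open>t \<ge> 0\<close> by fastforce
  then show ?thesis
  proof cases
    case 1
    \<comment> \<open>The exponent is 0 here, also when \<open>B = 0\<close>, since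
      \<open>0 / 0 = 0\<close> in \<open>ereal\<close>; so the claimed bound is 2.\<close>
    have "prob {\<omega> \<in> space M. \<bar>\<eta> \<omega>\<bar> \<ge> t} \<le> 1" by simp
    then show ?thesis
      using 1 \<open>B \<ge> 0\<close> \<open>C > 0\<close> by (simp add: g[unfolded 1] 1 exp_minus_def prob_space flip: zero_ereal_def)
  next
    case 2
    \<comment> \<open>Every \<open>s > 0\<close> is admissible and the quadratic term vanishes, so
      \<open>s\<close> can be sent to infinity.\<close>
    have "prob {\<omega> \<in> space M. \<bar>\<eta> \<omega>\<bar> \<ge> t} \<le> 0"
    proof (rule tendsto_lowerbound)
      show "((\<lambda>s. 2 * exp (- (s * t))) \<longlongrightarrow> 0) at_top"
        using \<open>t > 0\<close> by real_asymp
      show "\<forall>\<^sub>F s in at_top. prob {\<omega> \<in> space M. \<bar>\<eta> \<omega>\<bar> \<ge> t} \<le> 2 * exp (- (s * t))"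
        using eventually_gt_at_top[of 0] by eventually_elim (use le 2 in auto)
    qed auto
    also have "0 \<le> 2 * exp_minus (tail_exponent C d a x t)" by (simp add: exp_minus_def)
    finally show ?thesis .
  next
    case 3
    \<comment> \<open>The unconstrained minimiser is
      \<open>s = t / (2 * C\<^sup>2 * B\<^sup>2)\<close>; it is admissible precisely when
      \<open>t \<le> 2 * C * B\<close>.\<close>
    have "C\<^sup>2 * B\<^sup>2 * (t / (2 * C\<^sup>2 * B\<^sup>2))\<^sup>2 - t / (2 * C\<^sup>2 * B\<^sup>2) * t = - (t\<^sup>2 / (4 * C\<^sup>2 * B\<^sup>2))"
      using 3 \<open>C > 0\<close> by (simp add: field_simps power2_eq_square)
    moreover have "C * B * (t / (2 * C\<^sup>2 * B\<^sup>2)) \<le> 1"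
      using 3 \<open>C > 0\<close> by (simp add: field_simps power2_eq_square)
    ultimately show ?thesis
      using le[of "t / (2 * C\<^sup>2 * B\<^sup>2)"] 3 \<open>C > 0\<close> by (simp add: g exp_minus_def)
  next
    case 4
    \<comment> \<open>The unconstrained minimiser is now too large. The endpoint
      \<open>s = 1 / (C * B)\<close> makes the quadratic term 1, which is the source of the
      \<open>- 1\<close> in the exponent.\<close>
    then show ?thesis
      using le[of "1 / (C * B)"] \<open>C > 0\<close>
      by (simp add: g exp_minus_def power_divide power_mult_distrib one_ereal_def)
  qed
qed

end

section \<open>The tail bound for the chaos\<close>

theorem proposition3p5:
  fixes M :: "'a measure" and d n :: nat and A :: "(nat \<Rightarrow> nat) \<Rightarrow> real"
    and \<xi> :: "nat \<Rightarrow> 'a \<Rightarrow> real" and C t :: real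
  assumes "prob_space M"
    and "d \<ge> 1" and "n \<ge> 1"
    and "\<xi> \<in> L_psi M (real d) n"
    and "C > 0" and "mgf_constant C"
    and "t \<ge> 0"
  defines "S \<equiv> \<lambda>\<omega>. chaos d n A (\<lambda>i. \<xi> i \<omega>)"
  shows "measure M {\<omega> \<in> space M. \<bar>S \<omega> - integral\<^sup>L M S\<bar> \<ge> t}
    \<le> 2 * exp_minus (tail_exponent C d (array_norm d n (dual_exponent d) A)
                       (real_of_ereal (E_norm M (real d) n \<xi>)) t)"
proof -
  interpret prob_space M by fact
  define a where "a = array_norm d n (dual_exponent d) A"
  define x where "x = real_of_ereal (E_norm M (real d) n \<xi>)"
  have "a \<ge> 0" unfolding a_def using \<open>n \<ge> 1\<close> by (rule array_norm_nonneg)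
  have "0 \<le> E_norm M (real d) n \<xi>" "E_norm M (real d) n \<xi> < \<infinity>"
    using assms(2-4) by (auto intro!: E_norm_nonneg E_norm_finite simp del: ereal_infty_less)
  then have x: "E_norm M (real d) n \<xi> = ereal x" "x \<ge> 0"
    unfolding x_def by (cases "E_norm M (real d) n \<xi>"; simp)+
  have "(\<lambda>\<omega>. \<xi> i \<omega>) \<in> borel_measurable M" if "i \<in> {1..n}" for i
    using that assms(4) by (auto simp: L_psi_def)
  \<comment> \<open>Only the coordinates 1 to \<open>n\<close> are known to be measurable, so the
    range of the multi-indices matters.\<close>
  then have [measurable]: "S \<in> borel_measurable M"
    unfolding S_def chaos_def
    by (intro borel_measurable_sum borel_measurable_times borel_measurable_const borel_measurable_prod)
      (auto simp: multi_indices_def PiE_iff)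
  \<comment> \<open>By continuity some \<open>K\<close> slightly above \<open>x\<close> still
    satisfies \<open>a * K ^ d < L\<close>. Working strictly above \<open>a * x ^ d\<close> also
    covers the cases where \<open>a\<close> or \<open>x\<close> is 0.\<close>
  have psi: "(\<integral>\<^sup>+ \<omega>. ennreal (exp (\<bar>S \<omega>\<bar> / L)) \<partial>M) \<le> 2" if L: "L > a * x ^ d" for L
  proof -
    have "((\<lambda>K. a * K ^ d) \<longlongrightarrow> a * x ^ d) (at_right x)"
      by (intro tendsto_intros)
    then have "\<forall>\<^sub>F K in at_right x. a * K ^ d < L"
      using L by (rule order_tendstoD)
    then have "\<forall>\<^sub>F K in at_right x. x < K \<and> a * K ^ d < L"
      using eventually_at_right_less by (rule eventually_elim2) simp
    then obtain K where K: "x < K" "a * K ^ d < L"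
      using eventually_happens trivial_limit_at_right_real by blast
    have "K > 0" using K(1) x(2) by simp
    have "L > 0" using L \<open>a \<ge> 0\<close> x(2) by (smt (verit) mult_nonneg_nonneg zero_le_power)
    have "\<bar>S \<omega>\<bar> / L \<le> (\<Sum>i=1..n. \<bar>\<xi> i \<omega>\<bar> powr real d) / K powr real d" for \<omega>
    proof -
      define Y where "Y = (\<Sum>i=1..n. \<bar>\<xi> i \<omega>\<bar> ^ d)"
      have "Y \<ge> 0" by (auto simp: Y_def intro!: sum_nonneg)
      have "\<bar>S \<omega>\<bar> * K ^ d \<le> a * Y * K ^ d"
        using abs_chaos_le[OF \<open>d \<ge> 1\<close>, of n A "\<lambda>i. \<xi> i \<omega>"] \<open>K > 0\<close>
        by (intro mult_right_mono) (auto simp: S_def a_def Y_def)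
      also have "\<dots> = a * K ^ d * Y" by simp
      also have "\<dots> \<le> L * Y"
        using K \<open>Y \<ge> 0\<close> by (intro mult_right_mono) auto
      finally have "\<bar>S \<omega>\<bar> / L \<le> Y / K ^ d"
        using \<open>K > 0\<close> \<open>L > 0\<close> by (simp add: field_simps)
      then show ?thesis
        using \<open>K > 0\<close> \<open>d \<ge> 1\<close> by (simp add: Y_def powr_realpow')
    qed
    then have "(\<integral>\<^sup>+ \<omega>. ennreal (exp (\<bar>S \<omega>\<bar> / L)) \<partial>M)
      \<le> (\<integral>\<^sup>+ \<omega>. ennreal (exp ((\<Sum>i=1..n. \<bar>\<xi> i \<omega>\<bar> powr real d) / K powr real d)) \<partial>M)"
      by (intro nn_integral_mono ennreal_leI) simp
    also have "\<dots> \<le> 2"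
      using K(1) x(1) by (intro nn_integral_exp_le_2_if_E_norm_less) auto
    finally show ?thesis .
  qed
  have "a * x ^ d \<ge> 0" using \<open>a \<ge> 0\<close> x(2) by simp
  have int: "integrable M S"
  proof (rule integrable_if_nn_integral_exp_abs)
    show "(\<integral>\<^sup>+ \<omega>. ennreal (exp (\<bar>S \<omega>\<bar> / (a * x ^ d + 1))) \<partial>M) < \<infinity>"
      using psi[of "a * x ^ d + 1"] by (auto intro: le_less_trans)
  qed (use \<open>a * x ^ d \<ge> 0\<close> in auto)
  have "psi_norm M 1 (\<lambda>\<omega>. S \<omega> - expectation S) \<le> ereal (2 * (a * x ^ d))"
  proof (rule ereal_le_epsilon2)
    fix e :: real assume "e > 0"
    \<comment> \<open>Half of \<open>e\<close>, because centering doubles the scale.\<close>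
    define L where "L = a * x ^ d + e / 2"
    have L: "L > a * x ^ d" "L > 0" using \<open>e > 0\<close> \<open>a * x ^ d \<ge> 0\<close> by (auto simp: L_def)
    then have "psi_norm M 1 (\<lambda>\<omega>. S \<omega> - expectation S) \<le> ereal (2 * L)"
      by (intro psi_norm_1_le nn_integral_exp_abs_centered_le_2 psi) auto
    then show "psi_norm M 1 (\<lambda>\<omega>. S \<omega> - expectation S) \<le> ereal (2 * (a * x ^ d)) + ereal e"
      by (simp add: L_def algebra_simps)
  qed
  then show ?thesis
    using prob_abs_ge_le_tail_exponent[OF \<open>mgf_constant C\<close> \<open>C > 0\<close>, of "\<lambda>\<omega>. S \<omega> - expectation S"]
      int \<open>t \<ge> 0\<close>
    by (simp add: prob_space flip: a_def x_def)
qed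

end
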